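(* Let $d \ge 1$ be an integer. If $f:\mathbb{R}^d \to \mathbb{R}$ is a Zygmund function, then the graph of $f$ is thin for doubling measures. That is, if $\mu$ is a doubling measure on $\mathbb{R}^{d+1}$ and $E = \{(x, f(x)) : x \in \mathbb{R}^d\} \subset \mathbb{R}^{d+1}$ is the graph of $f$, then $\mu(E) = 0$.
   Context: The Zygmund class $\Lambda_*(\mathbb{R}^d)$ is the space of bounded continuous functions $f:\mathbb{R}^d \to \mathbb{R}$ for which $$\|f\|_* = \sup\left\{ \frac{|f(x+h)+f(x-h)-2f(x)|}{|h|} : x, h \in \mathbb{R}^d,\ h \neq 0 \right\} < \infty,$$ where $|h|$ denotes the (Euclidean) norm of $h \in \mathbb{R}^d$. Elements of $\Lambda_*(\mathbb{R}^d)$ are called Zygmund functions. A Borel measure $\mu$ on a metric space $X$ (here $X = \mathbb{R}^{d+1}$ with the Euclidean metric) is called doubling if there is a constant $C > 0$ such that $\mu(\bar{B}(x,r)) \le C\,\mu(\bar{B}(x,r/2))$ for all nonempty closed balls $\bar{B}(x,r)$, where $\bar{B}(x,r)$ is the closed ball of center $x$ and radius $r$. A subset $E$ of a metric space $X$ is thin (for doubling measures) if $\mu(E)=0$ for every doubling measure $\mu$ on $X$.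
   Formalization: Doubling measures are additionally required to be finite on closed balls; without this, counting measure satisfies the stated doubling condition and gives the graph infinite measure. Only measures infinite on every ball of positive radius are excluded. *)

theory Defs
  imports "HOL-Analysis.Analysis"
begin

definition zygmund_seminorm :: "('a::real_normed_vector \<Rightarrow> real) \<Rightarrow> ereal" where
  "zygmund_seminorm f =
     Sup {ereal (\<bar>f (x + h) + f (x - h) - 2 * f x\<bar> / norm h) | x h. h \<noteq> 0}"

definition zygmund :: "('a::real_normed_vector \<Rightarrow> real) \<Rightarrow> bool" where
  "zygmund f \<longleftrightarrow>
     continuous_on UNIV f \<and> bounded (range f) \<and> zygmund_seminorm f < \<infinity>"

(* Finiteness on balls is the usual implicit convention: without it any measure that is
   infinite on every ball of positive radius, such as counting measure on a Euclidean
   space, would count as doubling.  The zero measure is admitted. *)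
definition doubling_measure :: "'a::metric_space measure \<Rightarrow> bool" where
  "doubling_measure M \<longleftrightarrow>
     sets M = sets borel \<and>
     (\<forall>x r. emeasure M (cball x r) < \<infinity>) \<and>
     (\<exists>C::real. C > 0 \<and>
        (\<forall>x r. cball x r \<noteq> {} \<longrightarrow>
           emeasure M (cball x r) \<le> ennreal C * emeasure M (cball x (r / 2))))"

(* null_sets requires measurability of E; emeasure M E = 0 alone would hold trivially
   for non-Borel E. *)
definition thin_for_doubling :: "'a::metric_space set \<Rightarrow> bool" where
  "thin_for_doubling E \<longleftrightarrow> (\<forall>M. doubling_measure M \<longrightarrow> E \<in> null_sets M)"

end

theory Submission
  imports Defs
begin

text \<open>
  The graph of a Zygmund function is porous at every point and every scale, with one constant, and
  closed porous sets are null for every doubling measure.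

  Porosity (\<open>uniformly_porous_graph_of_second_difference_bound\<close>) comes from a dichotomy at a
  point \<open>x\<close> and a scale \<open>s\<close>. If the increments of \<open>f\<close> from \<open>x\<close> over the ball of radius \<open>s\<close>
  stay below a fixed multiple of \<open>s\<close>, the graph leaves a ball free above \<open>(x, f x)\<close>.
  Otherwise \<open>f\<close> climbs steeply from \<open>x\<close> to its maximum over the ball, and the second difference
  bound makes it behave like an affine function up to an error of order \<open>s\<close>; so near a point
  three quarters of the way to the maximum \<open>f\<close> stays well above \<open>f x\<close>, and the graph leaves a
  ball free beside \<open>(x, f x)\<close>, at height \<open>f x\<close>. The second case covers arbitrarily steep
  increments, as it must: a Zygmund function need not be Lipschitz.

  Nullity (\<open>compact_porous_null\<close>) is a covering argument. At scale \<open>r\<close>, cover a compact porous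
  set by bounded enlargements of disjoint balls centred on it. Each disjoint ball contains a hole of
  comparable radius, so by doubling the measure of the set is at most a constant times the measure
  of the union of the holes. The holes avoid the set but lie within \<open>2r\<close> of it, and the measure of
  such a collar tends to \<open>0\<close> with \<open>r\<close>.
\<close>

section \<open>Porous sets and doubling measures\<close>

text \<open>
  The hole is required to be centred near \<open>p\<close> rather than to be contained in a ball around \<open>p\<close>;
  the two versions differ only in the constant.
\<close>

definition uniformly_porous :: "'a::metric_space set \<Rightarrow> bool" where
  "uniformly_porous E \<longleftrightarrow>
     (\<exists>c>0. \<forall>p\<in>E. \<forall>r>0. \<exists>q. dist p q \<le> r \<and> cball q (c * r) \<inter> E = {})"

lemma uniformly_porous_subset:
  assumes "uniformly_porous E" "F \<subseteq> E"
  shows "uniformly_porous F"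
proof -
  obtain c where c: "c > 0" "\<And>p r. p \<in> E \<Longrightarrow> r > 0 \<Longrightarrow> \<exists>q. dist p q \<le> r \<and> cball q (c * r) \<inter> E = {}"
    using assms(1) unfolding uniformly_porous_def by blast
  have "\<exists>q. dist p q \<le> r \<and> cball q (c * r) \<inter> F = {}" if "p \<in> F" "r > 0" for p r
    using c(2)[of p r] that assms(2) by blast
  then show ?thesis
    unfolding uniformly_porous_def using c(1) by blast
qed

lemma doubling_measure_iterate:
  assumes C: "C > 0"
    and dbl: "\<And>x r. cball x r \<noteq> {} \<Longrightarrow> emeasure M (cball x r) \<le> ennreal C * emeasure M (cball x (r / 2))"
    and "r \<ge> 0"
  shows "emeasure M (cball x (2 ^ m * r)) \<le> ennreal (C ^ m) * emeasure M (cball x r)"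
proof (induction m)
  case 0
  show ?case by simp
next
  case (Suc m)
  have "cball x (2 ^ Suc m * r) \<noteq> {}"
    using \<open>r \<ge> 0\<close> by (simp add: not_less)
  from dbl[OF this]
  have "emeasure M (cball x (2 ^ Suc m * r)) \<le> ennreal C * emeasure M (cball x (2 ^ m * r))"
    by simp
  also have "\<dots> \<le> ennreal C * (ennreal (C ^ m) * emeasure M (cball x r))"
    by (intro mult_left_mono Suc.IH) simp
  also have "\<dots> = ennreal (C ^ Suc m) * emeasure M (cball x r)"
    using C by (simp add: ennreal_mult mult.assoc)
  finally show ?case .
qed

text \<open>
  Thinning a finite \<open>r\<close>-net to a maximal subset with gaps larger than \<open>4r\<close> keeps a
  \<open>5r\<close>-net, since every discarded point has a kept one within \<open>4r\<close>.
\<close>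

lemma compact_separated_net:
  fixes F :: "'a::metric_space set"
  assumes "compact F" "r > 0"
  obtains S where "finite S" "S \<subseteq> F" "\<And>s t. s \<in> S \<Longrightarrow> t \<in> S \<Longrightarrow> s \<noteq> t \<Longrightarrow> dist s t > 4 * r"
    "F \<subseteq> (\<Union>s\<in>S. cball s (5 * r))"
proof -
  have "F \<subseteq> (\<Union>t\<in>F. ball t r)"
    using \<open>r > 0\<close> by auto
  then obtain T where T: "T \<subseteq> F" "finite T" "F \<subseteq> (\<Union>t\<in>T. ball t r)"
    using compactE_image[OF \<open>compact F\<close>, of F "\<lambda>t. ball t r"] open_ball by blast
  define sep where "sep S \<longleftrightarrow> (\<forall>s\<in>S. \<forall>t\<in>S. s \<noteq> t \<longrightarrow> dist s t > 4 * r)" for S :: "'a set"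
  have "finite {S. S \<subseteq> T \<and> sep S}"
    using T(2) by simp
  moreover have "{} \<in> {S. S \<subseteq> T \<and> sep S}"
    by (simp add: sep_def)
  ultimately have "\<exists>S\<in>{S. S \<subseteq> T \<and> sep S}. \<forall>S'\<in>{S. S \<subseteq> T \<and> sep S}. S \<subseteq> S' \<longrightarrow> S = S'"
    by (intro finite_has_maximal) auto
  then obtain S where S: "S \<subseteq> T" "sep S"
    and max: "\<And>S'. S' \<subseteq> T \<Longrightarrow> sep S' \<Longrightarrow> S \<subseteq> S' \<Longrightarrow> S = S'"
    by auto
  have near: "\<exists>s\<in>S. dist s t \<le> 4 * r" if "t \<in> T" for t
  proof (rule ccontr)
    assume far: "\<not> ?thesis"
    then have "sep (insert t S)"
      using S(2) by (auto simp: sep_def dist_commute not_le)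
    then have "t \<in> S"
      using max[of "insert t S"] S(1) that by blast
    then show False
      using far \<open>r > 0\<close> by force
  qed
  have "F \<subseteq> (\<Union>s\<in>S. cball s (5 * r))"
  proof
    fix x assume "x \<in> F"
    then obtain t where t: "t \<in> T" "dist t x < r"
      using T(3) by auto
    obtain s where "s \<in> S" "dist s t \<le> 4 * r"
      using near[OF t(1)] by blast
    moreover have "dist s x \<le> dist s t + dist t x"
      by (rule dist_triangle)
    ultimately show "x \<in> (\<Union>s\<in>S. cball s (5 * r))"
      using t(2) by (intro UN_I[of s]) auto
  qed
  moreover have "finite S" "S \<subseteq> F"
    using S(1) T finite_subset by auto
  ultimately show thesis
    using that S(2) by (auto simp: sep_def)
qed

text \<open>
  The collars decrease to \<open>{}\<close> because a compact set is closed, and the first of them is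
  bounded and so has finite measure.
\<close>

lemma emeasure_collar_tendsto_0:
  fixes F :: "'a::metric_space set"
  assumes "compact F" "F \<noteq> {}" and sets: "sets M = sets borel"
    and fin: "\<And>x r. emeasure M (cball x r) < \<infinity>"
  shows "(\<lambda>n. emeasure M ({x. infdist x F \<le> 1 / real (Suc n)} - F)) \<longlonglongrightarrow> 0"
proof -
  define A where "A n = {x. infdist x F \<le> 1 / real (Suc n)} - F" for n
  have "closed F"
    using \<open>compact F\<close> by (rule compact_imp_closed)
  have meas: "A n \<in> sets M" for n
  proof -
    have "closed {x. infdist x F \<le> 1 / real (Suc n)}"
      by (intro closed_Collect_le continuous_intros)
    then show ?thesis
      unfolding A_def using \<open>closed F\<close> by (auto simp: sets)
  qed
  have "decseq A"
  proof (rule decseq_SucI)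
    fix n
    have "1 / real (Suc (Suc n)) \<le> 1 / real (Suc n)"
      by (simp add: frac_le)
    then show "A (Suc n) \<le> A n"
      unfolding A_def by fastforce
  qed
  obtain a R where R: "F \<subseteq> cball a R"
    using \<open>compact F\<close> compact_imp_bounded bounded_subset_cball by metis
  have fin_A: "emeasure M (A n) \<noteq> \<infinity>" for n
  proof -
    have "A n \<subseteq> cball a (R + 2)"
    proof
      fix x assume "x \<in> A n"
      then have "infdist x F \<le> 1 / real (Suc n)"
        by (simp add: A_def)
      moreover have "1 / real (Suc n) \<le> 1"
        by simp
      ultimately have "infdist x F < 2"
        by linarith
      then obtain y where "y \<in> F" "dist x y < 2"
        using \<open>F \<noteq> {}\<close> cInf_lessD[of "dist x ` F" 2] by (auto simp: infdist_notempty)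
      then have "dist a y \<le> R" "dist y x < 2"
        using R by (auto simp: dist_commute)
      then show "x \<in> cball a (R + 2)"
        using dist_triangle[of a x y] by simp
    qed
    then have "emeasure M (A n) \<le> emeasure M (cball a (R + 2))"
      by (rule emeasure_mono) (simp add: sets)
    then show ?thesis
      using fin[of a "R + 2"] by (auto simp: top_unique)
  qed
  have "(\<Inter>n. A n) = {}"
  proof (rule ccontr)
    assume "(\<Inter>n. A n) \<noteq> {}"
    then obtain x where x: "\<And>n. x \<in> A n" by blast
    then have "x \<notin> F" and le: "infdist x F \<le> 1 / real (Suc n)" for n
      by (auto simp: A_def)
    then have "infdist x F > 0"
      using infdist_pos_not_in_closed[OF \<open>closed F\<close> \<open>F \<noteq> {}\<close>] by blast
    then obtain n where "1 / real (Suc n) < infdist x F"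
      by (rule nat_approx_posE)
    then show False
      using le[of n] by simp
  qed
  moreover have "(\<lambda>n. emeasure M (A n)) \<longlonglongrightarrow> emeasure M (\<Inter>n. A n)"
    using meas by (intro Lim_emeasure_decseq \<open>decseq A\<close> fin_A) auto
  ultimately have "(\<lambda>n. emeasure M (A n)) \<longlonglongrightarrow> 0"
    by simp
  then show ?thesis
    unfolding A_def .
qed

lemma compact_porous_null:
  fixes F :: "'a::metric_space set"
  assumes "compact F" "uniformly_porous F" "doubling_measure M"
  shows "F \<in> null_sets M"
proof (cases "F = {}")
  case True
  then show ?thesis by simp
next
  case False
  obtain C where C: "C > 0"
    and sets: "sets M = sets borel"
    and fin: "\<And>x r. emeasure M (cball x r) < \<infinity>"
    and dbl: "\<And>x r. cball x r \<noteq> {} \<Longrightarrow> emeasure M (cball x r) \<le> ennreal C * emeasure M (cball x (r / 2))"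
    using assms(3) unfolding doubling_measure_def by blast
  obtain c where c: "c > 0"
    and hole: "\<And>p r. p \<in> F \<Longrightarrow> r > 0 \<Longrightarrow> \<exists>q. dist p q \<le> r \<and> cball q (c * r) \<inter> F = {}"
    using assms(2) unfolding uniformly_porous_def by blast
  (* Doubling m times turns a hole of radius c r into a ball of radius at least 6 r, which
     contains the ball of radius 5 r about the point that the hole belongs to. *)
  obtain m where m: "6 / c < 2 ^ m"
    using real_arch_pow[of 2 "6 / c"] by auto
  have "closed F"
    using assms(1) by (rule compact_imp_closed)
  have bound: "emeasure M F \<le> ennreal (C ^ m) * emeasure M ({x. infdist x F \<le> 2 * r} - F)"
    if "r > 0" for r
  proof -
    obtain S where S: "finite S" "S \<subseteq> F"
      and sep: "\<And>s t. s \<in> S \<Longrightarrow> t \<in> S \<Longrightarrow> s \<noteq> t \<Longrightarrow> dist s t > 4 * r"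
      and cover: "F \<subseteq> (\<Union>s\<in>S. cball s (5 * r))"
      using compact_separated_net[OF assms(1) \<open>r > 0\<close>] by metis
    obtain q where q: "\<And>p. p \<in> F \<Longrightarrow> dist p (q p) \<le> r"
      and q_hole: "\<And>p. p \<in> F \<Longrightarrow> cball (q p) (c * r) \<inter> F = {}"
      using hole[OF _ \<open>r > 0\<close>] by metis
    have hole_sub: "cball (q p) (c * r) \<subseteq> cball p (2 * r)" if "p \<in> F" for p
    proof
      have "p \<notin> cball (q p) (c * r)"
        using q_hole[OF that] that by blast
      then have "c * r < r"
        using q[OF that] by (simp add: dist_commute)
      moreover fix x assume "x \<in> cball (q p) (c * r)"
      ultimately show "x \<in> cball p (2 * r)"
        using q[OF that] dist_triangle[of p x "q p"] by simp
    qed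
    have disj: "disjoint_family_on (\<lambda>p. cball (q p) (c * r)) S"
      unfolding disjoint_family_on_def
    proof (intro ballI impI)
      fix s t assume st: "s \<in> S" "t \<in> S" "s \<noteq> t"
      have "cball s (2 * r) \<inter> cball t (2 * r) = {}"
      proof (rule ccontr)
        assume "cball s (2 * r) \<inter> cball t (2 * r) \<noteq> {}"
        then obtain x where "dist s x \<le> 2 * r" "dist t x \<le> 2 * r" by auto
        then show False
          using dist_triangle2[of s t x] sep[OF st] by simp
      qed
      then show "cball (q s) (c * r) \<inter> cball (q t) (c * r) = {}"
        using hole_sub[of s] hole_sub[of t] st S(2) by blast
    qed
    have ball_le: "emeasure M (cball p (5 * r)) \<le> ennreal (C ^ m) * emeasure M (cball (q p) (c * r))"
      if "p \<in> F" for p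
    proof -
      have "6 * r \<le> 2 ^ m * (c * r)"
        using m c \<open>r > 0\<close> by (simp add: field_simps)
      then have "dist p x \<le> 5 * r \<Longrightarrow> dist (q p) x \<le> 2 ^ m * (c * r)" for x
        using q[OF that] dist_triangle3[of "q p" x p] by linarith
      then have "cball p (5 * r) \<subseteq> cball (q p) (2 ^ m * (c * r))"
        by auto
      then have "emeasure M (cball p (5 * r)) \<le> emeasure M (cball (q p) (2 ^ m * (c * r)))"
        by (rule emeasure_mono) (simp add: sets)
      also have "\<dots> \<le> ennreal (C ^ m) * emeasure M (cball (q p) (c * r))"
        using doubling_measure_iterate[OF C dbl] c \<open>r > 0\<close> by simp
      finally show ?thesis .
    qed
    have "emeasure M F \<le> emeasure M (\<Union>s\<in>S. cball s (5 * r))"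
      using cover by (rule emeasure_mono) (auto simp: sets intro!: sets.finite_UN S(1))
    also have "\<dots> \<le> (\<Sum>s\<in>S. emeasure M (cball s (5 * r)))"
      by (rule emeasure_subadditive_finite) (auto simp: sets S(1))
    also have "\<dots> \<le> (\<Sum>s\<in>S. ennreal (C ^ m) * emeasure M (cball (q s) (c * r)))"
      using S(2) by (intro sum_mono ball_le) auto
    also have "\<dots> = ennreal (C ^ m) * emeasure M (\<Union>s\<in>S. cball (q s) (c * r))"
      unfolding sum_distrib_left[symmetric]
      by (subst sum_emeasure) (auto simp: sets S(1) disj)
    also have "\<dots> \<le> ennreal (C ^ m) * emeasure M ({x. infdist x F \<le> 2 * r} - F)"
    proof (intro mult_left_mono emeasure_mono subsetI)
      fix x assume "x \<in> (\<Union>s\<in>S. cball (q s) (c * r))"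
      then obtain s where s: "s \<in> F" "x \<in> cball (q s) (c * r)"
        using S(2) by blast
      then have "dist x s \<le> 2 * r"
        using hole_sub[of s] by (auto simp: dist_commute)
      moreover have "infdist x F \<le> dist x s"
        using s(1) by (rule infdist_le)
      ultimately show "x \<in> {x. infdist x F \<le> 2 * r} - F"
        using s q_hole[of s] by auto
    next
      have "closed {x. infdist x F \<le> 2 * r}"
        by (intro closed_Collect_le continuous_intros)
      then show "{x. infdist x F \<le> 2 * r} - F \<in> sets M"
        using \<open>closed F\<close> by (auto simp: sets)
    qed simp
    finally show ?thesis .
  qed
  have "(\<lambda>n. ennreal (C ^ m) * emeasure M ({x. infdist x F \<le> 1 / real (Suc n)} - F))
          \<longlonglongrightarrow> ennreal (C ^ m) * 0"
    by (intro ennreal_tendsto_cmult emeasure_collar_tendsto_0 assms(1) False sets fin) simp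
  moreover have "emeasure M F \<le> ennreal (C ^ m) * emeasure M ({x. infdist x F \<le> 1 / real (Suc n)} - F)" for n
  proof -
    have "2 * (1 / (2 * real (Suc n))) = 1 / real (Suc n)"
      by (simp del: of_nat_Suc)
    moreover have "1 / (2 * real (Suc n)) > 0"
      by simp
    ultimately show ?thesis
      using bound by metis
  qed
  ultimately have "emeasure M F \<le> ennreal (C ^ m) * 0"
    by (intro LIMSEQ_le_const) auto
  then show ?thesis
    using \<open>closed F\<close> by (auto simp: null_sets_def sets)
qed

theorem thin_for_doubling_closed_porous:
  fixes E :: "'a::heine_borel set"
  assumes "closed E" "uniformly_porous E"
  shows "thin_for_doubling E"
  unfolding thin_for_doubling_def
proof (intro allI impI)
  fix M :: "'a measure"
  assume M: "doubling_measure M"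
  fix a :: 'a
  have "E \<inter> cball a (real n) \<in> null_sets M" for n
  proof (rule compact_porous_null[OF _ _ M])
    show "compact (E \<inter> cball a (real n))"
      using assms(1) by (intro closed_Int_compact compact_cball)
    show "uniformly_porous (E \<inter> cball a (real n))"
      using assms(2) by (rule uniformly_porous_subset) blast
  qed
  then have "(\<Union>n. E \<inter> cball a (real n)) \<in> null_sets M"
    by blast
  moreover have "E = (\<Union>n. E \<inter> cball a (real n))"
    using real_arch_simple by auto
  ultimately show "E \<in> null_sets M"
    by simp
qed

section \<open>Graphs of functions with bounded second differences\<close>

lemma zygmund_second_difference_bound:
  fixes f :: "'a::real_normed_vector \<Rightarrow> real"
  assumes "zygmund f"
  obtains L where "L \<ge> 0" "\<And>x h. \<bar>f (x + h) + f (x - h) - 2 * f x\<bar> \<le> L * norm h"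
proof -
  have "zygmund_seminorm f \<noteq> \<infinity>"
    using assms by (simp add: zygmund_def)
  then obtain N :: nat where "zygmund_seminorm f < ereal (real N)"
    unfolding less_PInf_Ex_of_nat by (rule exE)
  then have L: "zygmund_seminorm f \<le> ereal (real N)"
    by (rule less_imp_le)
  have "\<bar>f (x + h) + f (x - h) - 2 * f x\<bar> \<le> real N * norm h" for x h
  proof (cases "h = 0")
    case False
    then have "ereal (\<bar>f (x + h) + f (x - h) - 2 * f x\<bar> / norm h) \<le> zygmund_seminorm f"
      unfolding zygmund_seminorm_def by (intro Sup_upper) blast
    then have "\<bar>f (x + h) + f (x - h) - 2 * f x\<bar> / norm h \<le> real N"
      using L by (meson ereal_less_eq(3) order_trans)
    then show ?thesis
      using False by (simp add: field_simps)
  qed simp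
  then show thesis
    using that[of "real N"] by simp
qed

text \<open>
  Two midpoint steps give \<open>f (x + (3/4) k) \<ge> f x + (3/4) M - L s / 4\<close>, where the maximum
  over the ball of radius \<open>s\<close> is \<open>f x + M\<close>, attained at \<open>x + k\<close>. Reflecting in
  \<open>x + (3/4) k\<close> keeps points within \<open>s / 4\<close> of it inside that ball, so a low value there
  would force a value above the maximum on the other side. The choice of
  three quarters matters: reflecting in the midpoint would give no gain over \<open>f x\<close>.
\<close>

lemma second_difference_steep_hole:
  fixes f :: "'a::{real_normed_vector, heine_borel} \<Rightarrow> real"
  assumes cont: "continuous_on UNIV f" and "s > 0"
    and L: "L \<ge> 0" "\<And>x h. \<bar>f (x + h) + f (x - h) - 2 * f x\<bar> \<le> L * norm h"
    and steep: "norm h \<le> s" "f (x + h) > f x + (1 + 2 * L) * s"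
  obtains y where "dist x y \<le> s" "\<And>z. dist y z \<le> s / 4 \<Longrightarrow> f z > f x + s / 4"
proof -
  have "\<exists>u\<in>cball x s. \<forall>v\<in>cball x s. f v \<le> f u"
    using \<open>s > 0\<close> continuous_on_subset[OF cont]
    by (intro continuous_attains_sup) auto
  then obtain u where u: "dist x u \<le> s" and max: "\<And>v. dist x v \<le> s \<Longrightarrow> f v \<le> f u"
    by auto
  define k where "k = u - x"
  have k: "norm k \<le> s"
    using u by (simp add: k_def dist_norm norm_minus_commute)
  have M: "f u > f x + (1 + 2 * L) * s"
    using max[of "x + h"] steep by (simp add: dist_norm)
  define y where "y = x + (3 / 4) *\<^sub>R k"
  have err: "L * norm (a *\<^sub>R k) \<le> a * (L * s)" if "a \<ge> 0" for a
    using mult_left_mono[OF k, of "a * L"] that L(1) by (simp add: mult_ac)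
  have half: "2 * f (x + (1 / 2) *\<^sub>R k) \<ge> f x + f u - 1 / 2 * (L * s)"
  proof -
    have *: "x + (1 / 2) *\<^sub>R k + (1 / 2) *\<^sub>R k = u" "x + (1 / 2) *\<^sub>R k - (1 / 2) *\<^sub>R k = x"
      by (simp_all add: k_def scaleR_add_left[symmetric] add.assoc)
    show ?thesis
      using L(2)[of "x + (1 / 2) *\<^sub>R k" "(1 / 2) *\<^sub>R k", unfolded *] err[of "1 / 2"] by linarith
  qed
  have threequarter: "2 * f y \<ge> f (x + (1 / 2) *\<^sub>R k) + f u - 1 / 4 * (L * s)"
  proof -
    have *: "y + (1 / 4) *\<^sub>R k = u" "y - (1 / 4) *\<^sub>R k = x + (1 / 2) *\<^sub>R k"
      by (simp_all add: y_def k_def scaleR_add_left[symmetric] scaleR_diff_left[symmetric] add.assoc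
            flip: add_diff_eq)
    show ?thesis
      using L(2)[of y "(1 / 4) *\<^sub>R k", unfolded *] err[of "1 / 4"] by linarith
  qed
  have xy: "dist x y \<le> 3 / 4 * s"
    using k by (simp add: y_def dist_norm)
  show thesis
  proof (rule that[of y])
    show "dist x y \<le> s"
      using xy \<open>s > 0\<close> by linarith
    fix z assume z: "dist y z \<le> s / 4"
    have nz: "norm (z - y) \<le> s / 4"
      using z by (simp add: dist_norm norm_minus_commute)
    have "dist x (y - (z - y)) \<le> dist x y + dist y (y - (z - y))"
      by (rule dist_triangle)
    also have "\<dots> \<le> s"
      using xy nz unfolding dist_norm[of y] by simp
    finally have "f (y - (z - y)) \<le> f u"
      by (rule max)
    moreover have "L * norm (z - y) \<le> 1 / 4 * (L * s)"
      using mult_left_mono[OF nz L(1)] by simp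
    ultimately have "f z \<ge> 2 * f y - f u - 1 / 4 * (L * s)"
      using L(2)[of y "z - y"] by simp
    moreover have "f u > f x + s + 2 * (L * s)"
      using M by (simp add: algebra_simps)
    moreover have "L * s \<ge> 0"
      using L(1) \<open>s > 0\<close> by simp
    ultimately show "f z > f x + s / 4"
      using half threequarter \<open>s > 0\<close> by linarith
  qed
qed

lemma uniformly_porous_graph_of_second_difference_bound:
  fixes f :: "'a::{real_normed_vector, heine_borel} \<Rightarrow> real"
  assumes cont: "continuous_on UNIV f"
    and L: "L \<ge> 0" "\<And>x h. \<bar>f (x + h) + f (x - h) - 2 * f x\<bar> \<le> L * norm h"
  shows "uniformly_porous (range (\<lambda>x. (x, f x)))"
  unfolding uniformly_porous_def
proof (intro exI[of _ "1 / (8 * (1 + L))"] conjI ballI allI impI)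
  show "1 / (8 * (1 + L)) > 0"
    using L(1) by simp
  fix p r assume "p \<in> range (\<lambda>x. (x, f x))" "(r::real) > 0"
  then obtain x where p: "p = (x, f x)" by auto
  (* The hole above the graph lies at height 2 (1 + L) s, which is to be the distance r.
     This clears the ceiling (1 + 2 L) s of the increments by s, leaving room for radius s / 4. *)
  define s where "s = r / (2 * (1 + L))"
  have s: "s > 0" "r = 2 * (1 + L) * s" "1 / (8 * (1 + L)) * r = s / 4"
    using \<open>r > 0\<close> L(1) by (simp_all add: s_def)
  have "L * s \<ge> 0"
    using L(1) s(1) by simp
  show "\<exists>q. dist p q \<le> r \<and> cball q (1 / (8 * (1 + L)) * r) \<inter> range (\<lambda>x. (x, f x)) = {}"
  proof (cases "\<exists>h. norm h \<le> s \<and> f (x + h) > f x + (1 + 2 * L) * s")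
    case True
    then obtain y where y: "dist x y \<le> s" "\<And>z. dist y z \<le> s / 4 \<Longrightarrow> f z > f x + s / 4"
      using second_difference_steep_hole[OF cont s(1) L] by metis
    have "dist p (y, f x) \<le> r"
      using y(1) \<open>L * s \<ge> 0\<close> s by (simp add: p dist_Pair_Pair algebra_simps)
    moreover have "(z, f z) \<notin> cball (y, f x) (s / 4)" for z
    proof
      assume "(z, f z) \<in> cball (y, f x) (s / 4)"
      then have "dist y z \<le> s / 4" "dist (f x) (f z) \<le> s / 4"
        using dist_fst_le[of "(y, f x)" "(z, f z)"] dist_snd_le[of "(y, f x)" "(z, f z)"] by auto
      then show False
        using y(2)[of z] unfolding dist_real_def by linarith
    qed
    ultimately show ?thesis
      unfolding s(3) by (intro exI[of _ "(y, f x)"]) auto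
  next
    case False
    define q where "q = (x, f x + r)"
    have "dist p q \<le> r"
      using \<open>r > 0\<close> by (simp add: p q_def dist_Pair_Pair dist_real_def)
    moreover have "(z, f z) \<notin> cball q (s / 4)" for z
    proof
      assume "(z, f z) \<in> cball q (s / 4)"
      then have "dist x z \<le> s / 4" "dist (f x + r) (f z) \<le> s / 4"
        using dist_fst_le[of q "(z, f z)"] dist_snd_le[of q "(z, f z)"] by (auto simp: q_def)
      moreover from this have "f z \<le> f x + (1 + 2 * L) * s"
        using False[simplified, rule_format, of "z - x"] s(1)
        by (simp add: dist_norm norm_minus_commute)
      ultimately show False
        using s by (simp add: dist_real_def algebra_simps)
    qed
    ultimately show ?thesis
      unfolding s(3) by (intro exI[of _ q]) auto
  qed
qed

lemma closed_graph:
  fixes f :: "'a::t2_space \<Rightarrow> 'b::t2_space"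
  assumes "continuous_on UNIV f"
  shows "closed (range (\<lambda>x. (x, f x)))"
proof -
  have "range (\<lambda>x. (x, f x)) = {p. snd p = f (fst p)}"
    by force
  moreover have "closed {p. snd p = f (fst p)}"
    by (intro closed_Collect_eq continuous_intros continuous_on_compose2[OF assms]) auto
  ultimately show ?thesis by simp
qed

theorem theorem2p6:
  fixes f :: "real ^ 'n \<Rightarrow> real"
  assumes "zygmund f"
  shows "thin_for_doubling {(x, f x) | x. x \<in> UNIV}"
proof -
  have cont: "continuous_on UNIV f"
    using assms by (simp add: zygmund_def)
  obtain L where "L \<ge> 0" "\<And>x h. \<bar>f (x + h) + f (x - h) - 2 * f x\<bar> \<le> L * norm h"
    using zygmund_second_difference_bound[OF assms] by blast
  then have "uniformly_porous (range (\<lambda>x. (x, f x)))"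
    using uniformly_porous_graph_of_second_difference_bound[OF cont] by blast
  then have "thin_for_doubling (range (\<lambda>x. (x, f x)))"
    using closed_graph[OF cont] by (intro thin_for_doubling_closed_porous)
  moreover have "{(x, f x) | x. x \<in> UNIV} = range (\<lambda>x. (x, f x))"
    by auto
  ultimately show ?thesis by simp
qed

end
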